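(* Let $b_1,\dots,b_n \in \mathbb{R}^m$ be an LLL-reduced basis of the lattice $L$, let $1 \le k \le j \le n$, and let $d_1,\dots,d_j$ be arbitrary linearly independent vectors in $L$. Then both of the following hold: $$\det L(b_1,\dots,b_k) \le 2^{k(n-j)/2 + k(j-k)/4}\, (\det L(d_1,\dots,d_j))^{k/j},$$ $$\|b_1\| \cdots \|b_k\| \le 2^{k(n-j)/2 + k(j-1)/4}\, (\det L(d_1,\dots,d_j))^{k/j}.$$
   Context: Throughout, $\langle\cdot,\cdot\rangle$ is the usual inner product on $\mathbb{R}^m$ and $\|\cdot\|$ the Euclidean norm. For linearly independent vectors $b_1,\dots,b_n\in\mathbb{R}^m$, the lattice they generate is $L(b_1,\dots,b_n)=\{\sum_{i=1}^n \lambda_i b_i : \lambda_i\in\mathbb{Z},\ i=1,\dots,n\}$, and $b_1,\dots,b_n$ is called a basis of it. The determinant of a lattice $L$ with basis matrix $B=[b_1,\dots,b_n]$ (columns $b_i$) is $\det L=\sqrt{\det(B^T B)}$, which does not depend on the choice of basis. The Gram-Schmidt vectors of a basis $b_1,\dots,b_n$ are $b_1^*=b_1$ and $b_i^*=b_i-\sum_{j=1}^{i-1}\mu_{ij}b_j^*$ for $i=2,\dots,n$, where $\mu_{ij}=\langle b_i,b_j^*\rangle/\langle b_j^*,b_j^*\rangle$. The basis $b_1,\dots,b_n$ of $L$ is LLL-reduced if $|\mu_{ji}|\le 1/2$ for $j=2,\dots,n$ and $i=1,\dots,j-1$, and $\|b_j^*+\mu_{j,j-1}b_{j-1}^*\|^2\ge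 \tfrac34\|b_{j-1}^*\|^2$ for $1<j\le n$. *)

theory Defs
  imports "HOL-Analysis.Analysis" "Jordan_Normal_Form.Determinant"
begin

text \<open>A family \<open>b\<^sub>1, \<dots>, b\<^sub>n\<close> is a function on \<open>nat\<close> of which only the values on \<open>{1..n}\<close> matter.\<close>

definition lin_indep_family :: "(nat \<Rightarrow> 'a::real_vector) \<Rightarrow> nat \<Rightarrow> bool" where
  "lin_indep_family b n \<longleftrightarrow> inj_on b {1..n} \<and> independent (b ` {1..n})"

definition lattice_gen :: "(nat \<Rightarrow> 'a::real_vector) \<Rightarrow> nat \<Rightarrow> 'a set" where
  "lattice_gen b n = range (\<lambda>c :: nat \<Rightarrow> int. \<Sum>i=1..n. real_of_int (c i) *\<^sub>R b i)"

definition lattice_basis :: "(nat \<Rightarrow> 'a::real_vector) \<Rightarrow> nat \<Rightarrow> 'a set \<Rightarrow> bool" where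
  "lattice_basis b n L \<longleftrightarrow> lin_indep_family b n \<and> lattice_gen b n = L"

text \<open>The matrix \<open>B\<^sup>T B\<close> for \<open>B\<close> with columns \<open>b\<^sub>1, \<dots>, b\<^sub>n\<close>; matrix indices start at 0. The size
  \<open>n\<close> is not a type here, hence the matrices of \<open>Jordan_Normal_Form\<close>.\<close>

definition gram_mat :: "(nat \<Rightarrow> 'a::real_inner) \<Rightarrow> nat \<Rightarrow> real mat" where
  "gram_mat b n = Matrix.mat n n (\<lambda>(i, j). inner (b (Suc i)) (b (Suc j)))"

text \<open>A function of the lattice as a set; independence of the basis is \<open>lattice_det_eq\<close> below.\<close>

definition lattice_det :: "'a::real_inner set \<Rightarrow> real" where
  "lattice_det L =
    (THE D. \<exists>b n. lattice_basis b n L \<and> D = sqrt (Determinant.det (gram_mat b n)))"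

fun gs_vec :: "(nat \<Rightarrow> 'a::real_inner) \<Rightarrow> nat \<Rightarrow> 'a" where
  "gs_vec b i =
    b i - (\<Sum>j=1..<i. (inner (b i) (gs_vec b j) / inner (gs_vec b j) (gs_vec b j)) *\<^sub>R gs_vec b j)"

declare gs_vec.simps [simp del]

definition gs_mu :: "(nat \<Rightarrow> 'a::real_inner) \<Rightarrow> nat \<Rightarrow> nat \<Rightarrow> real" where
  "gs_mu b i j = inner (b i) (gs_vec b j) / inner (gs_vec b j) (gs_vec b j)"

definition LLL_reduced :: "(nat \<Rightarrow> 'a::real_inner) \<Rightarrow> nat \<Rightarrow> bool" where
  "LLL_reduced b n \<longleftrightarrow>
    (\<forall>j\<in>{2..n}. \<forall>i\<in>{1..j-1}. \<bar>gs_mu b j i\<bar> \<le> 1/2) \<and>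
    (\<forall>j. 1 < j \<and> j \<le> n \<longrightarrow>
      (norm (gs_vec b j + gs_mu b j (j-1) *\<^sub>R gs_vec b (j-1)))\<^sup>2 \<ge> 3/4 * (norm (gs_vec b (j-1)))\<^sup>2)"

lemma lattice_gen_mem:
  assumes "i \<in> {1..n}"
  shows "b i \<in> lattice_gen b n"
proof -
  have "(\<Sum>l=1..n. real_of_int (if l = i then 1 else 0) *\<^sub>R b l)
      = (\<Sum>l=1..n. if l = i then b l else 0)"
    by (rule sum.cong) auto
  also have "\<dots> = b i"
    using assms by (subst sum.delta) auto
  finally show ?thesis
    unfolding lattice_gen_def by (intro range_eqI[where x = "\<lambda>l. if l = i then 1 else 0"]) simp
qed

lemma span_lattice_gen: "span (lattice_gen b n) = span (b ` {1..n})"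
proof (rule span_eq[THEN iffD2], intro conjI subsetI)
  fix x assume "x \<in> lattice_gen b n"
  then show "x \<in> span (b ` {1..n})"
    unfolding lattice_gen_def by (auto intro!: span_sum span_scale intro: span_base)
next
  fix x assume "x \<in> b ` {1..n}"
  then show "x \<in> span (lattice_gen b n)"
    using lattice_gen_mem[of _ n b] by (auto intro: span_base)
qed

lemma lattice_basis_card:
  assumes "lattice_basis b n L" "lattice_basis c p L"
  shows "n = p"
proof -
  have ind: "independent (b ` {1..n})" "independent (c ` {1..p})"
    and "lattice_gen b n = lattice_gen c p"
    using assms unfolding lattice_basis_def lin_indep_family_def by auto
  then have "span (b ` {1..n}) = span (c ` {1..p})"
    using span_lattice_gen[of b n] span_lattice_gen[of c p] by simp
  then have "card (b ` {1..n}) = card (c ` {1..p})"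
    using dim_eq_card[OF _ ind(1), of "c ` {1..p}"] dim_eq_card[OF refl ind(2)] by simp
  then show ?thesis
    using assms unfolding lattice_basis_def lin_indep_family_def by (simp add: card_image)
qed

lemma det_gram_sublattice:
  fixes b c :: "nat \<Rightarrow> 'a::real_inner"
  assumes "\<And>i. i \<in> {1..n} \<Longrightarrow> c i \<in> lattice_gen b n"
  shows "\<exists>z::int. Determinant.det (gram_mat c n) = (of_int z)\<^sup>2 * Determinant.det (gram_mat b n)"
proof -
  have "\<forall>i\<in>{1..n}. \<exists>f::nat\<Rightarrow>int. c i = (\<Sum>l=1..n. real_of_int (f l) *\<^sub>R b l)"
    using assms unfolding lattice_gen_def by blast
  then obtain f :: "nat \<Rightarrow> nat \<Rightarrow> int"
    where f: "\<And>i. i \<in> {1..n} \<Longrightarrow> c i = (\<Sum>l=1..n. real_of_int (f i l) *\<^sub>R b l)"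
    by metis
  have f': "c (Suc i) = (\<Sum>l=0..<n. real_of_int (f (Suc i) (Suc l)) *\<^sub>R b (Suc l))" if "i < n" for i
    using f[of "Suc i"] that by (simp add: sum.atLeast1_atMost_eq atLeast0LessThan)
  define Z where "Z = Matrix.mat n n (\<lambda>(i, l). f (Suc i) (Suc l))"
  define R where "R = map_mat real_of_int Z"
  have R: "R \<in> carrier_mat n n" and G: "gram_mat b n \<in> carrier_mat n n"
    unfolding R_def Z_def gram_mat_def by auto
  have "gram_mat c n = R * gram_mat b n * transpose_mat R"
  proof (rule eq_matI)
    fix i j
    assume "i < dim_row (R * gram_mat b n * transpose_mat R)"
      and "j < dim_col (R * gram_mat b n * transpose_mat R)"
    then have ij: "i < n" "j < n" using R by auto
    have "(R * gram_mat b n * transpose_mat R) $$ (i, j)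
      = (\<Sum>l=0..<n. (R * gram_mat b n) $$ (i, l) * R $$ (j, l))"
      using ij R G by (simp add: scalar_prod_def del: assoc_mult_mat)
    also have "\<dots> = (\<Sum>l=0..<n. (\<Sum>k=0..<n. R $$ (i, k) * gram_mat b n $$ (k, l)) * R $$ (j, l))"
      using ij R G by (intro sum.cong refl) (simp add: scalar_prod_def)
    also have "\<dots> = (\<Sum>l=0..<n. (\<Sum>k=0..<n. real_of_int (f (Suc i) (Suc k))
        * inner (b (Suc k)) (b (Suc l))) * real_of_int (f (Suc j) (Suc l)))"
      using ij by (simp add: R_def Z_def gram_mat_def)
    also have "\<dots> = inner (c (Suc i)) (c (Suc j))"
      unfolding f'[OF ij(1)] f'[OF ij(2)] inner_sum_right
      by (intro sum.cong refl) (simp only: inner_scaleR_right inner_scaleR_left inner_sum_left mult.commute)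
    finally show "gram_mat c n $$ (i, j) = (R * gram_mat b n * transpose_mat R) $$ (i, j)"
      using ij unfolding gram_mat_def by simp
  qed (auto simp: R_def Z_def gram_mat_def)
  then have "Determinant.det (gram_mat c n)
      = Determinant.det R * Determinant.det (gram_mat b n) * Determinant.det R"
    using Determinant.det_mult[OF mult_carrier_mat[OF R G], of "transpose_mat R"]
      Determinant.det_mult[OF R G] Determinant.det_transpose[OF R] R by simp
  moreover have "Determinant.det R = of_int (Determinant.det Z)"
    unfolding R_def by (rule of_int_hom.hom_det)
  ultimately show ?thesis
    by (intro exI[of _ "Determinant.det Z"]) (simp add: power2_eq_square)
qed

lemma det_gram_basis_unique:
  fixes b c :: "nat \<Rightarrow> 'a::real_inner"
  assumes "lattice_basis b n L" "lattice_basis c p L"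
  shows "Determinant.det (gram_mat b n) = Determinant.det (gram_mat c p)"
proof -
  have p: "p = n" using lattice_basis_card[OF assms] by simp
  have gen: "lattice_gen b n = L" "lattice_gen c n = L"
    using assms unfolding lattice_basis_def p by auto
  obtain z where z: "Determinant.det (gram_mat c n) = (real_of_int z)\<^sup>2 * Determinant.det (gram_mat b n)"
    using det_gram_sublattice[of n c b] lattice_gen_mem[of _ n c] gen by metis
  obtain w where w: "Determinant.det (gram_mat b n) = (real_of_int w)\<^sup>2 * Determinant.det (gram_mat c n)"
    using det_gram_sublattice[of n b c] lattice_gen_mem[of _ n b] gen by metis
  show ?thesis
  proof (cases "Determinant.det (gram_mat b n) = 0")
    case True
    then show ?thesis using z p by simp
  next
    case False
    have "(real_of_int w)\<^sup>2 * (real_of_int z)\<^sup>2 = 1"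
      using z w False by (metis mult.assoc mult_cancel_right1)
    then have "real_of_int (w\<^sup>2 * z\<^sup>2) = 1" by simp
    then have "w\<^sup>2 * z\<^sup>2 = 1" by linarith
    then have "z\<^sup>2 dvd 1" by (metis dvd_triv_right)
    then have "z\<^sup>2 = 1" by simp
    then have "(real_of_int z)\<^sup>2 = 1" by (metis of_int_1 of_int_power)
    then show ?thesis using z p by simp
  qed
qed

lemma lattice_det_eq:
  assumes "lattice_basis b n L"
  shows "lattice_det L = sqrt (Determinant.det (gram_mat b n))"
  unfolding lattice_det_def
proof (rule the_equality)
  show "\<exists>c p. lattice_basis c p L \<and> sqrt (Determinant.det (gram_mat b n)) = sqrt (Determinant.det (gram_mat c p))"
    using assms by blast
next
  fix D
  assume "\<exists>c p. lattice_basis c p L \<and> D = sqrt (Determinant.det (gram_mat c p))"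
  then obtain c p where "lattice_basis c p L" and D: "D = sqrt (Determinant.det (gram_mat c p))"
    by blast
  then show "D = sqrt (Determinant.det (gram_mat b n))"
    unfolding D using det_gram_basis_unique[of c p L b n] assms by simp
qed

end

theory Submission
  imports Defs
begin

text \<open>
  Write \<open>\<beta>\<^sub>i\<close> for the length of the \<open>i\<close>-th Gram-Schmidt vector of \<open>b\<close>. Everything reduces to these
  lengths, because a lattice determinant is the product of the Gram-Schmidt lengths of any basis
  (\<open>lattice_det_eq_prod_gs\<close>), and because LLL reduction makes them fall slowly: from one index
  to the next they shrink by at most a factor \<open>\<surd>2\<close>, so \<open>\<beta>\<^sub>i \<le> 2\<^bsup>(l - i)/2\<^esup> \<beta>\<^sub>l\<close> for \<open>i \<le> l\<close>.

  Two independent estimates are combined. The first compares the \<open>j\<close> leading lengths with the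
  sublattice, \<open>\<beta>\<^sub>1 \<cdots> \<beta>\<^sub>j \<le> 2\<^bsup>j(n - j)/2\<^esup> det L(d\<^sub>1, \<dots>, d\<^sub>j)\<close> (\<open>prod_gs_le_sublattice\<close>). The idea is
  that a sublattice of rank \<open>j\<close> has an echelon basis with respect to \<open>b\<close>, with pivots
  \<open>s\<^sub>1 < \<dots> < s\<^sub>j\<close>. Pivot coefficients are nonzero integers, so the determinant is at least
  \<open>\<beta>\<^bsub>s\<^sub>1\<^esub> \<cdots> \<beta>\<^bsub>s\<^sub>j\<^esub>\<close>; and \<open>s\<^sub>l - l \<le> n - j\<close> bounds the loss in replacing \<open>s\<^sub>l\<close> by \<open>l\<close>. The formal
  proof never names the pivots: it peels off one basis vector \<open>b\<^sub>n\<close> at a time, and the only echelon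
  step needed is a basis of the sublattice of which at most the last vector involves \<open>b\<^sub>n\<close>
  (\<open>lattice_basis_in_kernel_except_last\<close>).

  The second estimate passes from \<open>j\<close> to \<open>k\<close> lengths (\<open>prod_prefix_le\<close>): since
  \<open>2\<^bsup>i/2\<^esup> \<beta>\<^sub>i\<close> is nondecreasing in \<open>i\<close>, the geometric mean of its first \<open>k\<close> terms is at most that of
  its first \<open>j\<close> terms, which is
  \<open>\<beta>\<^sub>1 \<cdots> \<beta>\<^sub>k \<le> 2\<^bsup>k(j - k)/4\<^esup> (\<beta>\<^sub>1 \<cdots> \<beta>\<^sub>j)\<^bsup>k/j\<^esup>\<close>. Together they bound the determinant of
  \<open>L(b\<^sub>1, \<dots>, b\<^sub>k)\<close>. For the product of the norms, size reduction gives
  \<open>\<parallel>b\<^sub>i\<parallel> \<le> 2\<^bsup>(i - 1)/2\<^esup> \<beta>\<^sub>i\<close> (\<open>LLL_norm_le_gs_norm\<close>); the additional factors multiply to \<open>2\<^bsup>k(k - 1)/4\<^esup>\<close>,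
  and \<open>k(j - k)/4 + k(k - 1)/4 = k(j - 1)/4\<close>.
\<close>

section \<open>Gram-Schmidt vectors and the Gram determinant\<close>

text \<open>The indices start at 1 because the sum in the recursion does: the vector of index 0 is never
  projected away from the others.\<close>

lemma gs_vec_orthogonal:
  assumes "1 \<le> i" "i < j"
  shows "inner (gs_vec b j) (gs_vec b i) = 0"
  using assms
proof (induction j arbitrary: i rule: less_induct)
  case (less j)
  have orth: "inner (gs_vec b l) (gs_vec b i) = 0" if "l \<in> {1..<j} - {i}" for l
    using that less.IH[of l i] less.IH[of i l] less.prems
    by (cases "l < i") (auto simp: inner_commute)
  have "inner (gs_vec b j) (gs_vec b i) = inner (b j) (gs_vec b i)
      - (\<Sum>l=1..<j. inner (b j) (gs_vec b l) / inner (gs_vec b l) (gs_vec b l)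
          * inner (gs_vec b l) (gs_vec b i))"
    by (subst gs_vec.simps) (simp add: inner_diff_left inner_sum_left)
  also have "(\<Sum>l=1..<j. inner (b j) (gs_vec b l) / inner (gs_vec b l) (gs_vec b l)
          * inner (gs_vec b l) (gs_vec b i)) = inner (b j) (gs_vec b i)"
    using less.prems orth by (subst sum.remove[of _ i]) auto
  finally show ?case by simp
qed

definition gs_coeff :: "(nat \<Rightarrow> 'a::real_inner) \<Rightarrow> nat \<Rightarrow> nat \<Rightarrow> real" where
  "gs_coeff b i l = (if l < i then gs_mu b i l else if l = i then 1 else 0)"

lemma gs_expansion:
  assumes "i \<in> {1..n}"
  shows "b i = (\<Sum>l=1..n. gs_coeff b i l *\<^sub>R gs_vec b l)"
proof -
  have "(\<Sum>l=1..n. gs_coeff b i l *\<^sub>R gs_vec b l) = (\<Sum>l=1..i. gs_coeff b i l *\<^sub>R gs_vec b l)"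
    using assms by (intro sum.mono_neutral_right) (auto simp: gs_coeff_def)
  also have "{1..i} = insert i {1..<i}"
    using assms by auto
  also have "(\<Sum>l\<in>insert i {1..<i}. gs_coeff b i l *\<^sub>R gs_vec b l)
      = gs_vec b i + (\<Sum>l=1..<i. gs_mu b i l *\<^sub>R gs_vec b l)"
    by (simp add: gs_coeff_def)
  also have "\<dots> = b i"
    by (subst gs_vec.simps[of b i]) (simp add: gs_mu_def)
  finally show ?thesis by simp
qed

lemma inner_gs_expansion:
  assumes "i \<in> {1..n}" "j \<in> {1..n}"
  shows "inner (b i) (b j) = (\<Sum>l=1..n. gs_coeff b i l * gs_coeff b j l * (norm (gs_vec b l))\<^sup>2)"
proof -
  have "inner (b i) (gs_vec b l) = gs_coeff b i l * (norm (gs_vec b l))\<^sup>2" if "l \<in> {1..n}" for l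
  proof -
    have "inner (gs_vec b p) (gs_vec b l) = 0" if "p \<in> {1..n} - {l}" for p
      using that \<open>l \<in> {1..n}\<close> gs_vec_orthogonal[of p l b] gs_vec_orthogonal[of l p b]
      by (cases "p < l") (auto simp: inner_commute)
    then show ?thesis
      using that by (subst gs_expansion[OF assms(1)])
        (simp add: inner_add_left inner_sum_left sum.remove[of _ l] power2_norm_eq_inner)
  qed
  then show ?thesis
    by (subst gs_expansion[OF assms(2), of b])
      (auto simp: inner_sum_right mult_ac intro!: sum.cong)
qed

text \<open>Scaling the Gram-Schmidt coordinates by the lengths of the orthogonal vectors gives a triangular
  factor \<open>W\<close> with \<open>W W\<^sup>T\<close> the Gram matrix (a Cholesky factor) and these lengths on its diagonal.\<close>

lemma sqrt_det_gram_mat: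
  "sqrt (Determinant.det (gram_mat b n)) = (\<Prod>i=1..n. norm (gs_vec b i))"
proof -
  define W where
    "W = Matrix.mat n n (\<lambda>(i, l). gs_coeff b (Suc i) (Suc l) * norm (gs_vec b (Suc l)))"
  have W: "W \<in> carrier_mat n n"
    by (simp add: W_def)
  have "gram_mat b n = W * transpose_mat W"
  proof (rule eq_matI)
    fix i j
    assume "i < dim_row (W * transpose_mat W)" "j < dim_col (W * transpose_mat W)"
    then have ij: "i < n" "j < n" using W by auto
    have "(W * transpose_mat W) $$ (i, j) = (\<Sum>l=0..<n. W $$ (i, l) * W $$ (j, l))"
      using ij W by (simp add: scalar_prod_def)
    also have "\<dots> = (\<Sum>l=0..<n. gs_coeff b (Suc i) (Suc l) * gs_coeff b (Suc j) (Suc l)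
        * (norm (gs_vec b (Suc l)))\<^sup>2)"
      using ij by (simp add: W_def power2_eq_square mult_ac)
    also have "\<dots> = inner (b (Suc i)) (b (Suc j))"
      using ij by (subst inner_gs_expansion[of _ n])
        (auto simp: sum.atLeast1_atMost_eq atLeast0LessThan)
    finally show "gram_mat b n $$ (i, j) = (W * transpose_mat W) $$ (i, j)"
      using ij by (simp add: gram_mat_def)
  qed (auto simp: gram_mat_def W_def)
  then have "Determinant.det (gram_mat b n) = (Determinant.det W)\<^sup>2"
    using W by (simp add: Determinant.det_mult[OF W] Determinant.det_transpose[OF W] power2_eq_square)
  moreover have "Determinant.det W = (\<Prod>i=1..n. norm (gs_vec b i))"
  proof -
    have "Determinant.det W = prod_list (diag_mat W)"
      by (rule det_lower_triangular[OF _ W]) (auto simp: W_def gs_coeff_def)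
    also have "\<dots> = (\<Prod>i=0..<n. W $$ (i, i))"
      using W by (simp add: prod_list_diag_prod)
    also have "\<dots> = (\<Prod>i=1..n. norm (gs_vec b i))"
      by (simp add: W_def gs_coeff_def prod.atLeast1_atMost_eq atLeast0LessThan)
    finally show ?thesis .
  qed
  ultimately show ?thesis
    by (simp add: prod_nonneg)
qed

lemma gs_vec_span:
  "gs_vec b i - b i \<in> span (b ` {1..<i})"
proof (induction i rule: less_induct)
  case (less i)
  have mem: "gs_vec b l \<in> span (b ` {1..<i})" if "l \<in> {1..<i}" for l
  proof -
    have "b ` {1..<l} \<subseteq> b ` {1..<i}" using that by auto
    then have "gs_vec b l - b l \<in> span (b ` {1..<i})"
      using less[of l] that span_mono[of "b ` {1..<l}" "b ` {1..<i}"] by auto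
    from span_add[OF this span_base[of "b l"]] show ?thesis
      using that by simp
  qed
  have "gs_vec b i - b i
      = - (\<Sum>j=1..<i. (inner (b i) (gs_vec b j) / inner (gs_vec b j) (gs_vec b j)) *\<^sub>R gs_vec b j)"
    by (subst gs_vec.simps) simp
  also have "\<dots> \<in> span (b ` {1..<i})"
    by (intro span_neg span_sum span_scale mem)
  finally show ?case .
qed

lemma lin_indep_family_mono:
  assumes "lin_indep_family b n" "k \<le> n"
  shows "lin_indep_family b k"
proof -
  have "{1..k} \<subseteq> {1..n}" using assms by auto
  then show ?thesis
    using assms inj_on_subset independent_mono[OF _ image_mono]
    unfolding lin_indep_family_def by blast
qed

lemma gs_vec_nonzero:
  assumes "lin_indep_family b n" "i \<in> {1..n}"
  shows "gs_vec b i \<noteq> 0"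
proof
  assume "gs_vec b i = 0"
  then have "b i \<in> span (b ` {1..<i})"
    using span_neg[OF gs_vec_span[of b i]] by simp
  moreover have "b ` {1..<i} \<subseteq> b ` {1..n} - {b i}"
  proof -
    have "b l \<noteq> b i" if "l \<in> {1..<i}" for l
      using inj_onD[of b "{1..n}" l i] assms that unfolding lin_indep_family_def by auto
    then show ?thesis using assms(2) by auto
  qed
  ultimately have "b i \<in> span (b ` {1..n} - {b i})"
    using span_mono by blast
  then show False
    using assms unfolding lin_indep_family_def dependent_def by blast
qed

lemma lattice_det_eq_prod_gs:
  assumes "lattice_basis b n L"
  shows "lattice_det L = (\<Prod>i=1..n. norm (gs_vec b i))"
  using lattice_det_eq[OF assms] sqrt_det_gram_mat by metis

lemma lattice_basis_gen: "lin_indep_family b n \<Longrightarrow> lattice_basis b n (lattice_gen b n)"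
  by (simp add: lattice_basis_def)

section \<open>Changing the basis of a lattice\<close>

lemma lattice_gen_add_scale:
  assumes "x \<in> lattice_gen b n" "y \<in> lattice_gen b n"
  shows "x + real_of_int z *\<^sub>R y \<in> lattice_gen b n"
proof -
  obtain f g :: "nat \<Rightarrow> int" where
    "x = (\<Sum>i=1..n. real_of_int (f i) *\<^sub>R b i)" "y = (\<Sum>i=1..n. real_of_int (g i) *\<^sub>R b i)"
    using assms unfolding lattice_gen_def by blast
  then have "x + real_of_int z *\<^sub>R y = (\<Sum>i=1..n. real_of_int (f i + z * g i) *\<^sub>R b i)"
    by (simp add: scaleR_sum_right sum.distrib[symmetric] algebra_simps)
  then show ?thesis
    unfolding lattice_gen_def by (intro range_eqI[of _ _ "\<lambda>i. f i + z * g i"])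
qed

lemma lattice_gen_subset:
  assumes "\<And>i. i \<in> {1..p} \<Longrightarrow> c i \<in> lattice_gen b n"
  shows "lattice_gen c p \<subseteq> lattice_gen b n"
proof
  fix x assume "x \<in> lattice_gen c p"
  then obtain f :: "nat \<Rightarrow> int" where x: "x = (\<Sum>i=1..p. real_of_int (f i) *\<^sub>R c i)"
    unfolding lattice_gen_def by blast
  have zero: "0 \<in> lattice_gen b n"
    unfolding lattice_gen_def by (intro range_eqI[of _ _ "\<lambda>_. 0"]) simp
  have "(\<Sum>i\<in>A. real_of_int (f i) *\<^sub>R c i) \<in> lattice_gen b n" if "finite A" "A \<subseteq> {1..p}" for A
    using that
  proof (induction A rule: finite_induct)
    case (insert i A)
    then show ?case
      using lattice_gen_add_scale[OF insert.IH assms[of i], of "f i"] by (simp add: add.commute)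
  qed (simp add: zero)
  then show "x \<in> lattice_gen b n"
    unfolding x by simp
qed

text \<open>Independence of the new family need not be checked by hand: \<open>n\<close> vectors spanning an
  \<open>n\<close>-dimensional space are distinct and independent.\<close>

lemma lattice_basis_exchange:
  fixes c c' :: "nat \<Rightarrow> 'a::euclidean_space"
  assumes c: "lattice_basis c n L"
    and "\<And>i. i \<in> {1..n} \<Longrightarrow> c' i \<in> L" "\<And>i. i \<in> {1..n} \<Longrightarrow> c i \<in> lattice_gen c' n"
  shows "lattice_basis c' n L"
proof -
  have L: "L = lattice_gen c n" and ind: "independent (c ` {1..n})" and inj: "inj_on c {1..n}"
    using c unfolding lattice_basis_def lin_indep_family_def by auto
  have gen: "lattice_gen c' n = L"
    using assms(2,3) lattice_gen_subset[of n c' c n] lattice_gen_subset[of n c c' n]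
    unfolding L by blast
  define V where "V = span (c ` {1..n})"
  have V: "V = span (c' ` {1..n})"
    using gen span_lattice_gen[of c n] span_lattice_gen[of c' n] unfolding V_def L by simp
  have dim: "dim V = n"
    using dim_eq_card[OF V_def[unfolded V_def, symmetric] ind] inj
    unfolding V_def by (simp add: dim_eq_card_independent[OF ind] card_image)
  have le: "card (c' ` {1..n}) \<le> n"
    using card_image_le[of "{1..n}" c'] by simp
  have "independent (c' ` {1..n})"
    by (rule card_le_dim_spanning[of _ V]) (use le dim V span_superset[of "c' ` {1..n}"] in simp_all)
  moreover from this have "inj_on c' {1..n}"
    using dim unfolding V by (intro eq_card_imp_inj_on) (simp_all add: dim_eq_card_independent)
  ultimately show ?thesis
    using gen unfolding lattice_basis_def lin_indep_family_def by simp
qed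

lemma lattice_basis_add_multiple:
  fixes c :: "nat \<Rightarrow> 'a::euclidean_space"
  assumes c: "lattice_basis c n L" and pq: "p \<in> {1..n}" "q \<in> {1..n}" "p \<noteq> q"
  shows "lattice_basis (c(p := c p + real_of_int z *\<^sub>R c q)) n L"
proof (rule lattice_basis_exchange[OF c])
  let ?c = "c(p := c p + real_of_int z *\<^sub>R c q)"
  have L: "L = lattice_gen c n"
    using c unfolding lattice_basis_def by simp
  show "?c i \<in> L" if "i \<in> {1..n}" for i
    using lattice_gen_add_scale[OF lattice_gen_mem[OF pq(1)] lattice_gen_mem[OF pq(2)], of c z]
      lattice_gen_mem[OF that, of c] unfolding L by simp
  have mem: "?c i \<in> lattice_gen ?c n" if "i \<in> {1..n}" for i
    using that by (rule lattice_gen_mem)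
  show "c i \<in> lattice_gen ?c n" if "i \<in> {1..n}" for i
    using lattice_gen_add_scale[OF mem[OF pq(1)] mem[OF pq(2)], of "-z"] mem[OF that] pq(3)
    by (cases "i = p") auto
qed

lemma lattice_basis_permute:
  fixes c :: "nat \<Rightarrow> 'a::euclidean_space"
  assumes c: "lattice_basis c n L" and \<pi>: "bij_betw \<pi> {1..n} {1..n}"
  shows "lattice_basis (c \<circ> \<pi>) n L"
proof (rule lattice_basis_exchange[OF c])
  have L: "L = lattice_gen c n"
    using c unfolding lattice_basis_def by simp
  show "(c \<circ> \<pi>) i \<in> L" if "i \<in> {1..n}" for i
    using lattice_gen_mem[OF bij_betw_apply[OF \<pi> that], of c] unfolding L by simp
  show "c i \<in> lattice_gen (c \<circ> \<pi>) n" if "i \<in> {1..n}" for i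
  proof -
    have "i \<in> \<pi> ` {1..n}"
      using that unfolding bij_betw_imp_surj_on[OF \<pi>] .
    then obtain l where "l \<in> {1..n}" "i = \<pi> l"
      by blast
    then show ?thesis
      using lattice_gen_mem[of l n "c \<circ> \<pi>"] by simp
  qed
qed

text \<open>The Euclidean algorithm on the values of \<open>\<phi>\<close>, phrased as a minimality argument: in a basis for
  which the sum of the \<open>\<bar>\<phi> c\<^sub>i\<bar>\<close> is least, two nonzero values cannot coexist, because adding or
  subtracting the vector with the smaller value would decrease the larger one.\<close>

lemma lattice_basis_in_kernel_except_last:
  fixes c :: "nat \<Rightarrow> 'a::euclidean_space" and \<phi> :: "'a \<Rightarrow> real"
  assumes c: "lattice_basis c n L" and \<phi>: "linear \<phi>" and int: "\<And>x. x \<in> L \<Longrightarrow> \<phi> x \<in> \<int>"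
  shows "\<exists>c'. lattice_basis c' n L \<and> (\<forall>i\<in>{1..<n}. \<phi> (c' i) = 0)"
proof -
  \<comment> \<open>The values are integers on \<open>L\<close>; the floor only turns them into naturals, so that a minimum
    exists.\<close>
  define size where "size c = (\<Sum>i=1..n. nat \<lfloor>\<bar>\<phi> (c i)\<bar>\<rfloor>)" for c :: "nat \<Rightarrow> 'a"
  define c' where "c' = arg_min size (\<lambda>c. lattice_basis c n L)"
  have c': "lattice_basis c' n L" and min: "\<And>e. lattice_basis e n L \<Longrightarrow> size c' \<le> size e"
    using arg_min_nat_lemma[of "\<lambda>c. lattice_basis c n L" c size] c unfolding c'_def by auto
  have int': "\<phi> (c' i) \<in> \<int>" if "i \<in> {1..n}" for i
    using int lattice_gen_mem[OF that, of c'] c' unfolding lattice_basis_def by simp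
  have no_smaller: False
    if pq: "p \<in> {1..n}" "q \<in> {1..n}" "p \<noteq> q" "\<phi> (c' q) \<noteq> 0" "\<bar>\<phi> (c' q)\<bar> \<le> \<bar>\<phi> (c' p)\<bar>" for p q
  proof -
    \<comment> \<open>The sign is chosen so that the two values partly cancel.\<close>
    define z :: int where "z = (if \<phi> (c' p) * \<phi> (c' q) > 0 then -1 else 1)"
    define e where "e = c'(p := c' p + real_of_int z *\<^sub>R c' q)"
    have "lattice_basis e n L"
      unfolding e_def using c' pq by (intro lattice_basis_add_multiple)
    then have "size c' \<le> size e" by (rule min)
    moreover have "size e < size c'"
    proof -
      obtain u v :: int where uv: "\<phi> (c' p) = of_int u" "\<phi> (c' q) = of_int v"
        using int'[OF pq(1)] int'[OF pq(2)] by (auto elim!: Ints_cases)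
      have z: "z = (if u * v > 0 then -1 else 1)"
        unfolding z_def uv by (simp flip: of_int_mult)
      have "v \<noteq> 0" "\<bar>v\<bar> \<le> \<bar>u\<bar>"
        using pq uv by auto
      then have "\<bar>u + z * v\<bar> < \<bar>u\<bar>"
        unfolding z by (auto simp: zero_less_mult_iff)
      moreover have "\<phi> (e p) = of_int (u + z * v)"
        unfolding e_def using uv by (simp add: linear_add[OF \<phi>] linear_scale[OF \<phi>])
      ultimately have "nat \<lfloor>\<bar>\<phi> (e p)\<bar>\<rfloor> < nat \<lfloor>\<bar>\<phi> (c' p)\<bar>\<rfloor>"
        unfolding uv by (metis abs_ge_zero floor_of_int nat_less_eq_zless of_int_abs)
      moreover have "nat \<lfloor>\<bar>\<phi> (e i)\<bar>\<rfloor> = nat \<lfloor>\<bar>\<phi> (c' i)\<bar>\<rfloor>" if "i \<noteq> p" for i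
        using that by (simp add: e_def)
      ultimately show ?thesis
        unfolding size_def using pq(1) by (simp only: sum.remove[of "{1..n}" p] finite_atLeastAtMost) simp
    qed
    ultimately show False by simp
  qed
  show ?thesis
  proof (cases "\<exists>q\<in>{1..n}. \<phi> (c' q) \<noteq> 0")
    case False
    then show ?thesis using c' by auto
  next
    case True
    then obtain q where q: "q \<in> {1..n}" "\<phi> (c' q) \<noteq> 0" by blast
    have others: "\<phi> (c' p) = 0" if "p \<in> {1..n}" "p \<noteq> q" for p
      using no_smaller[of p q] no_smaller[of q p] that q by force
    have "bij_betw (Transposition.transpose q n) {1..n} {1..n}"
      using q by (intro bij_betw_byWitness[where f' = "Transposition.transpose q n"])
        (auto simp: Transposition.transpose_def)
    from lattice_basis_permute[OF c' this]
    have "lattice_basis (c' \<circ> Transposition.transpose q n) n L" .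
    moreover have "\<phi> ((c' \<circ> Transposition.transpose q n) i) = 0" if "i \<in> {1..<n}" for i
      using that q by (auto simp: Transposition.transpose_def intro!: others)
    ultimately show ?thesis by blast
  qed
qed

section \<open>Determinants of sublattices\<close>

lemma lin_indep_family_le_dim:
  fixes b c :: "nat \<Rightarrow> 'a::euclidean_space"
  assumes "lin_indep_family c j" "\<And>i. i \<in> {1..j} \<Longrightarrow> c i \<in> lattice_gen b n"
  shows "j \<le> n"
proof -
  have "c ` {1..j} \<subseteq> span (lattice_gen b n)"
    using assms(2) span_base by blast
  also have "\<dots> = span (b ` {1..n})"
    by (rule span_lattice_gen)
  finally have "c ` {1..j} \<subseteq> span (b ` {1..n})" .
  moreover have "independent (c ` {1..j})" "inj_on c {1..j}"
    using assms(1) unfolding lin_indep_family_def by blast+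
  ultimately have "card (c ` {1..j}) \<le> card (b ` {1..n})"
    using independent_span_bound[of "b ` {1..n}" "c ` {1..j}"] by blast
  also have "\<dots> \<le> n"
    using card_image_le[of "{1..n}" b] by simp
  finally show ?thesis
    using card_image[OF \<open>inj_on c {1..j}\<close>] by simp
qed

text \<open>The last Gram-Schmidt vector is orthogonal to all earlier basis vectors, so pairing with it reads
  off the last coordinate. On the lattice this coordinate is an integer, and its kernel is the
  lattice of the remaining basis vectors.\<close>

lemma last_coordinate:
  fixes b :: "nat \<Rightarrow> 'a::real_inner"
  assumes b: "lin_indep_family b (Suc n)"
  defines "\<phi> \<equiv> \<lambda>x. inner x (gs_vec b (Suc n)) / (norm (gs_vec b (Suc n)))\<^sup>2"
  shows "\<phi> (\<Sum>i=1..Suc n. f i *\<^sub>R b i) = f (Suc n)"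
proof -
  let ?g = "gs_vec b (Suc n)"
  have orth: "inner (gs_vec b l) ?g = 0" if "l \<in> {1..n}" for l
    using that gs_vec_orthogonal[of l "Suc n" b] by (simp add: inner_commute)
  have "inner (b i) ?g = 0" if "i \<in> {1..n}" for i
    by (subst gs_expansion[OF that]) (simp add: inner_sum_left orth)
  moreover have "inner (b (Suc n)) ?g = (norm ?g)\<^sup>2"
    by (subst gs_expansion[of "Suc n" "Suc n"])
      (simp_all add: inner_add_left inner_sum_left orth power2_norm_eq_inner gs_coeff_def)
  moreover have "?g \<noteq> 0"
    using gs_vec_nonzero[OF b] by simp
  ultimately show ?thesis
    unfolding \<phi>_def by (simp add: inner_sum_left inner_add_left)
qed

text \<open>Induction on \<open>n\<close>. Choose a basis \<open>c\<close> of the sublattice in which only \<open>c\<^sub>j\<close> may involve the last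
  basis vector. If it does not either, then the sublattice already lies in the lattice of rank one less.
  Otherwise the last coordinate of \<open>c\<^sub>j\<close> is a nonzero integer and is not changed by orthogonalising
  against \<open>c\<^sub>1, \<dots>, c\<^bsub>j-1\<^esub>\<close>, so the last Gram-Schmidt vector of \<open>c\<close> is at least as long as that of
  \<open>b\<close>; the other \<open>c\<^sub>i\<close> are covered by the induction hypothesis.\<close>

lemma prod_gs_le_sublattice:
  fixes b d :: "nat \<Rightarrow> 'a::euclidean_space"
  assumes "lin_indep_family b n"
    and "\<And>i l. \<lbrakk>1 \<le> i; i \<le> l; l \<le> n\<rbrakk>
      \<Longrightarrow> norm (gs_vec b i) \<le> 2 powr ((real l - real i) / 2) * norm (gs_vec b l)"
    and "lin_indep_family d j" and "\<And>i. i \<in> {1..j} \<Longrightarrow> d i \<in> lattice_gen b n"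
  shows "(\<Prod>i=1..j. norm (gs_vec b i))
    \<le> 2 powr (real j * (real n - real j) / 2) * (\<Prod>i=1..j. norm (gs_vec d i))"
  using assms
proof (induction n arbitrary: d j)
  case 0
  then have "j = 0"
    using lin_indep_family_le_dim[of d j b 0] by simp
  then show ?case by simp
next
  case (Suc n)
  note b = Suc.prems(1) and ratio = Suc.prems(2) and d = Suc.prems(3) and dL = Suc.prems(4)
  have jn: "j \<le> Suc n"
    using lin_indep_family_le_dim[OF d dL] .
  have bn: "lin_indep_family b n"
    using b lin_indep_family_mono by (metis le_SucI order_refl)
  define g where "g = gs_vec b (Suc n)"
  have g0: "norm g > 0"
    using gs_vec_nonzero[OF b] by (simp add: g_def)
  define \<phi> where "\<phi> x = inner x g / (norm g)\<^sup>2" for x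
  have lin: "linear \<phi>"
    unfolding \<phi>_def by (intro linearI) (simp_all add: inner_add_left add_divide_distrib)
  have coord: "\<phi> (\<Sum>i=1..Suc n. f i *\<^sub>R b i) = f (Suc n)" for f
    using last_coordinate[OF b] unfolding \<phi>_def g_def .
  have int: "\<phi> x \<in> \<int>" if "x \<in> lattice_gen b (Suc n)" for x
  proof -
    obtain f :: "nat \<Rightarrow> int" where "x = (\<Sum>i=1..Suc n. real_of_int (f i) *\<^sub>R b i)"
      using \<open>x \<in> lattice_gen b (Suc n)\<close> unfolding lattice_gen_def by blast
    then show ?thesis
      using coord[of "\<lambda>i. real_of_int (f i)"] by simp
  qed
  have drop: "x \<in> lattice_gen b n" if "x \<in> lattice_gen b (Suc n)" "\<phi> x = 0" for x
  proof -
    obtain f :: "nat \<Rightarrow> int" where f: "x = (\<Sum>i=1..Suc n. real_of_int (f i) *\<^sub>R b i)"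
      using \<open>x \<in> lattice_gen b (Suc n)\<close> unfolding lattice_gen_def by blast
    have "f (Suc n) = 0"
      using coord[of "\<lambda>i. real_of_int (f i)"] that(2) unfolding f by simp
    then show ?thesis
      unfolding f lattice_gen_def by simp
  qed
  have sub: "lattice_gen d j \<subseteq> lattice_gen b (Suc n)"
    using dL by (rule lattice_gen_subset)
  obtain c where c: "lattice_basis c j (lattice_gen d j)"
    and c0: "\<And>i. i \<in> {1..<j} \<Longrightarrow> \<phi> (c i) = 0"
    using lattice_basis_in_kernel_except_last[OF lattice_basis_gen[OF d] lin] int sub by blast
  have cd: "(\<Prod>i=1..j. norm (gs_vec d i)) = (\<Prod>i=1..j. norm (gs_vec c i))"
    using lattice_det_eq_prod_gs[OF c] lattice_det_eq_prod_gs[OF lattice_basis_gen[OF d]] by simp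
  have ci: "lin_indep_family c j" and cgen: "lattice_gen c j = lattice_gen d j"
    using c unfolding lattice_basis_def by auto
  have cL: "c i \<in> lattice_gen b (Suc n)" if "i \<in> {1..j}" for i
    using lattice_gen_mem[OF that, of c] sub unfolding cgen by blast
  have IH: "(\<Prod>i=1..p. norm (gs_vec b i))
      \<le> 2 powr (real p * (real n - real p) / 2) * (\<Prod>i=1..p. norm (gs_vec c i))"
    if "p \<le> j" "\<And>i. i \<in> {1..p} \<Longrightarrow> \<phi> (c i) = 0" for p
    using that cL by (intro Suc.IH[OF bn] ratio lin_indep_family_mono[OF ci] drop) auto
  show ?case
  proof (cases "\<forall>i\<in>{1..j}. \<phi> (c i) = 0")
    case True
    have "(\<Prod>i=1..j. norm (gs_vec b i))
        \<le> 2 powr (real j * (real n - real j) / 2) * (\<Prod>i=1..j. norm (gs_vec c i))"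
      using IH[of j] True by simp
    also have "\<dots> \<le> 2 powr (real j * (real (Suc n) - real j) / 2) * (\<Prod>i=1..j. norm (gs_vec c i))"
      by (intro mult_right_mono powr_mono divide_right_mono mult_left_mono) (auto intro: prod_nonneg)
    finally show ?thesis unfolding cd .
  next
    case False
    then obtain i where "i \<in> {1..j}" "\<phi> (c i) \<noteq> 0" by blast
    then have "i = j" and j1: "j \<ge> 1"
      using c0[of i] by force+
    then have cj: "\<phi> (c j) \<noteq> 0" using \<open>\<phi> (c i) \<noteq> 0\<close> by simp
    then obtain p where p: "j = Suc p" using j1 by (cases j) auto
    have "span (c ` {1..<j}) \<subseteq> {x. \<phi> x = 0}"
      using c0 by (intro span_minimal) (auto intro: linear_subspace_kernel[OF lin])
    then have "\<phi> (gs_vec c j - c j) = 0"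
      using gs_vec_span by blast
    then have eq: "\<phi> (gs_vec c j) = \<phi> (c j)"
      by (simp add: linear_diff[OF lin])
    have "1 \<le> \<bar>\<phi> (c j)\<bar>"
      using int[OF cL[of j]] cj j1 Ints_nonzero_abs_ge1 by auto
    also have "\<bar>\<phi> (c j)\<bar> = \<bar>inner (gs_vec c j) g\<bar> / (norm g)\<^sup>2"
      unfolding eq[symmetric] by (simp add: \<phi>_def)
    also have "\<dots> \<le> norm (gs_vec c j) * norm g / (norm g)\<^sup>2"
      by (intro divide_right_mono Cauchy_Schwarz_ineq2) simp
    also have "\<dots> = norm (gs_vec c j) / norm g"
      by (simp add: power2_eq_square)
    finally have last: "norm g \<le> norm (gs_vec c j)"
      using g0 by (simp add: field_simps)
    have "norm (gs_vec b j) \<le> 2 powr ((real (Suc n) - real j) / 2) * norm g"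
      unfolding g_def using j1 jn by (intro ratio) auto
    also have "\<dots> \<le> 2 powr ((real (Suc n) - real j) / 2) * norm (gs_vec c j)"
      using last by (intro mult_left_mono) auto
    finally have step: "norm (gs_vec b j) \<le> 2 powr ((real n - real p) / 2) * norm (gs_vec c j)"
      unfolding p by simp
    have "(\<Prod>i=1..j. norm (gs_vec b i)) = (\<Prod>i=1..p. norm (gs_vec b i)) * norm (gs_vec b j)"
      unfolding p by simp
    also have "\<dots> \<le> (2 powr (real p * (real n - real p) / 2) * (\<Prod>i=1..p. norm (gs_vec c i)))
        * (2 powr ((real n - real p) / 2) * norm (gs_vec c j))"
      using c0 p by (intro mult_mono IH step mult_nonneg_nonneg prod_nonneg) auto
    also have "\<dots> = 2 powr (real p * (real n - real p) / 2 + (real n - real p) / 2)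
        * (\<Prod>i=1..j. norm (gs_vec c i))"
      unfolding p by (simp add: powr_add)
    also have "real p * (real n - real p) / 2 + (real n - real p) / 2
        = real j * (real (Suc n) - real j) / 2"
      unfolding p by (simp add: field_simps)
    finally show ?thesis unfolding cd .
  qed
qed

section \<open>Reduced bases\<close>

text \<open>Pythagoras turns the exchange condition into \<open>\<beta>\<^bsub>i+1\<^esub>\<^sup>2 \<ge> (3/4 - \<mu>\<^sup>2) \<beta>\<^sub>i\<^sup>2\<close>, and \<open>\<mu>\<^sup>2 \<le> 1/4\<close> by size
  reduction.\<close>

lemma LLL_gs_norm_sq_step:
  assumes "LLL_reduced b n" "1 \<le> i" "Suc i \<le> n"
  shows "(norm (gs_vec b i))\<^sup>2 \<le> 2 * (norm (gs_vec b (Suc i)))\<^sup>2"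
proof -
  let ?\<mu> = "gs_mu b (Suc i) i"
  have "\<forall>j\<in>{2..n}. \<forall>i\<in>{1..j-1}. \<bar>gs_mu b j i\<bar> \<le> 1/2"
    and lov: "\<forall>j. 1 < j \<and> j \<le> n \<longrightarrow>
      (norm (gs_vec b j + gs_mu b j (j-1) *\<^sub>R gs_vec b (j-1)))\<^sup>2 \<ge> 3/4 * (norm (gs_vec b (j-1)))\<^sup>2"
    using assms(1) unfolding LLL_reduced_def by blast+
  then have "\<bar>?\<mu>\<bar> \<le> 1/2"
    using assms by simp
  then have \<mu>: "?\<mu>\<^sup>2 \<le> 1/4"
    using abs_le_square_iff[of ?\<mu> "1/2"] by (simp add: power2_eq_square)
  have "3/4 * (norm (gs_vec b i))\<^sup>2 \<le> (norm (gs_vec b (Suc i) + ?\<mu> *\<^sub>R gs_vec b i))\<^sup>2"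
    using lov[rule_format, of "Suc i"] assms by simp
  also have "\<dots> = (norm (gs_vec b (Suc i)))\<^sup>2 + ?\<mu>\<^sup>2 * (norm (gs_vec b i))\<^sup>2"
    using gs_vec_orthogonal[of i "Suc i" b] assms
    by (subst norm_add_Pythagorean) (simp_all add: real_inner_class.orthogonal_def power_mult_distrib)
  also have "\<dots> \<le> (norm (gs_vec b (Suc i)))\<^sup>2 + 1/4 * (norm (gs_vec b i))\<^sup>2"
    using \<mu> by (intro add_left_mono mult_right_mono) auto
  finally show ?thesis by simp
qed

lemma LLL_gs_norm_sq_le:
  assumes "LLL_reduced b n" "1 \<le> i" "i \<le> l" "l \<le> n"
  shows "(norm (gs_vec b i))\<^sup>2 \<le> 2 ^ (l - i) * (norm (gs_vec b l))\<^sup>2"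
  using assms(3,4)
proof (induction l rule: dec_induct)
  case (step l)
  have "(norm (gs_vec b i))\<^sup>2 \<le> 2 ^ (l - i) * (norm (gs_vec b l))\<^sup>2"
    using step by simp
  also have "\<dots> \<le> 2 ^ (l - i) * (2 * (norm (gs_vec b (Suc l)))\<^sup>2)"
    using LLL_gs_norm_sq_step[OF assms(1), of l] assms(2) step by (intro mult_left_mono) auto
  also have "\<dots> = 2 ^ (Suc l - i) * (norm (gs_vec b (Suc l)))\<^sup>2"
    using step by (simp add: Suc_diff_le)
  finally show ?case .
qed simp

lemma le_powr_half_mult:
  fixes x y :: real
  assumes "x\<^sup>2 \<le> 2 ^ e * y\<^sup>2" "y \<ge> 0"
  shows "x \<le> 2 powr (real e / 2) * y"
proof (rule power2_le_imp_le)
  have "(2 powr (real e / 2))\<^sup>2 = (2::real) ^ e"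
    by (simp add: powr_powr powr_realpow flip: powr_numeral)
  then show "x\<^sup>2 \<le> (2 powr (real e / 2) * y)\<^sup>2"
    using assms(1) by (simp add: power_mult_distrib)
qed (use assms in simp)

lemma LLL_gs_norm_le:
  assumes "LLL_reduced b n" "1 \<le> i" "i \<le> l" "l \<le> n"
  shows "norm (gs_vec b i) \<le> 2 powr ((real l - real i) / 2) * norm (gs_vec b l)"
  using le_powr_half_mult[OF LLL_gs_norm_sq_le[OF assms]] assms by simp

text \<open>In \<open>\<parallel>b\<^sub>i\<parallel>\<^sup>2 = \<beta>\<^sub>i\<^sup>2 + \<Sum> \<mu>\<^sub>i\<^sub>l\<^sup>2 \<beta>\<^sub>l\<^sup>2\<close> the terms with \<open>l < i\<close> are at most \<open>2\<^bsup>i-l\<^esup> \<beta>\<^sub>i\<^sup>2 / 4\<close>, a geometric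
  progression whose total, with the leading 1, is \<open>1/2 + 2\<^sup>i / 4 \<le> 2\<^bsup>i-1\<^esup>\<close>.\<close>

lemma LLL_norm_le_gs_norm:
  assumes "LLL_reduced b n" "i \<in> {1..n}"
  shows "norm (b i) \<le> 2 powr ((real i - 1) / 2) * norm (gs_vec b i)"
proof -
  let ?g = "\<lambda>l. (norm (gs_vec b l))\<^sup>2"
  have coeff: "(gs_coeff b i l)\<^sup>2 * ?g l \<le> 1/4 * (2 ^ (i - l) * ?g i)" if "l \<in> {1..<i}" for l
  proof (rule mult_mono)
    have "\<bar>gs_mu b i l\<bar> \<le> 1/2"
      using assms that unfolding LLL_reduced_def by auto
    then show "(gs_coeff b i l)\<^sup>2 \<le> 1/4"
      using that abs_le_square_iff[of "gs_mu b i l" "1/2"] by (simp add: gs_coeff_def power2_eq_square)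
    show "?g l \<le> 2 ^ (i - l) * ?g i"
      using that assms by (intro LLL_gs_norm_sq_le) auto
  qed auto
  have geom: "(\<Sum>l=1..<p. (2::real) ^ (p - l)) = 2 ^ p - 2" if "p \<ge> 1" for p
    using that
  proof (induction p rule: nat_induct_at_least)
    case (Suc p)
    have "(\<Sum>l=1..<Suc p. (2::real) ^ (Suc p - l)) = (\<Sum>l=1..<p. 2 * 2 ^ (p - l)) + 2"
      using Suc.hyps by (simp add: Suc_diff_le)
    also have "\<dots> = 2 * (2 ^ p - 2) + 2"
      using Suc.IH by (simp flip: sum_distrib_left)
    finally show ?case by simp
  qed simp
  have "(norm (b i))\<^sup>2 = (\<Sum>l=1..i. (gs_coeff b i l)\<^sup>2 * ?g l)"
    using assms inner_gs_expansion[of i i i b]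
    by (simp add: power2_norm_eq_inner[of "b i"] power2_eq_square[of "gs_coeff b i _"])
  also have "{1..i} = insert i {1..<i}"
    using assms by auto
  also have "(\<Sum>l\<in>insert i {1..<i}. (gs_coeff b i l)\<^sup>2 * ?g l)
      = ?g i + (\<Sum>l=1..<i. (gs_coeff b i l)\<^sup>2 * ?g l)"
    by (simp add: gs_coeff_def)
  also have "\<dots> \<le> ?g i + (\<Sum>l=1..<i. 1/4 * (2 ^ (i - l) * ?g i))"
    using coeff by (intro add_left_mono sum_mono)
  also have "\<dots> = (1 + 1/4 * (\<Sum>l=1..<i. 2 ^ (i - l))) * ?g i"
    by (simp add: sum_distrib_left sum_distrib_right algebra_simps)
  also have "\<dots> = (1/2 + 2 ^ i / 4) * ?g i"
    using geom[of i] assms by (simp add: diff_divide_distrib)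
  also have "\<dots> \<le> 2 ^ (i - 1) * ?g i"
  proof (rule mult_right_mono)
    obtain p where "i = Suc p" using assms by (cases i) auto
    then have "(2::real) ^ i = 2 * 2 ^ (i - 1)" "(1::real) \<le> 2 ^ (i - 1)"
      by simp_all
    then show "1/2 + 2 ^ i / 4 \<le> (2::real) ^ (i - 1)"
      by linarith
  qed simp
  finally show ?thesis
    using le_powr_half_mult[of "norm (b i)" "i - 1"] assms by (simp add: of_nat_diff)
qed

section \<open>Partial products of slowly decreasing sequences\<close>

lemma sum_prefix_mean_le:
  fixes x :: "nat \<Rightarrow> real"
  assumes "k \<le> j" and mono: "\<And>i l. \<lbrakk>1 \<le> i; i \<le> l; l \<le> j\<rbrakk> \<Longrightarrow> x i \<le> x l"
  shows "real j * (\<Sum>i=1..k. x i) \<le> real k * (\<Sum>i=1..j. x i)"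
  using assms
proof (induction j rule: dec_induct)
  case (step j)
  have "(\<Sum>i=1..k. x i) \<le> (\<Sum>i=1..k. x (Suc j))"
    using step by (intro sum_mono) auto
  moreover have "real j * (\<Sum>i=1..k. x i) \<le> real k * (\<Sum>i=1..j. x i)"
    using step by auto
  ultimately show ?case
    by (simp add: algebra_simps)
qed simp

text \<open>The hypothesis says that \<open>log\<^sub>2 \<beta>\<^sub>i + i/2\<close> is nondecreasing, so its prefix means increase as well.
  The means of the summands \<open>i/2\<close> differ by \<open>(j - k)/4\<close>, whence the exponent.\<close>

lemma prod_prefix_le:
  fixes \<beta> :: "nat \<Rightarrow> real"
  assumes "1 \<le> k" "k \<le> j" and pos: "\<And>i. i \<in> {1..j} \<Longrightarrow> \<beta> i > 0"
    and ratio: "\<And>i l. \<lbrakk>1 \<le> i; i \<le> l; l \<le> j\<rbrakk> \<Longrightarrow> \<beta> i \<le> 2 powr ((real l - real i) / 2) * \<beta> l"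
  shows "(\<Prod>i=1..k. \<beta> i) \<le> 2 powr (real k * (real j - real k) / 4) * (\<Prod>i=1..j. \<beta> i) powr (real k / real j)"
proof -
  have log_le: "log 2 (\<beta> i) + real i / 2 \<le> log 2 (\<beta> l) + real l / 2" if "1 \<le> i" "i \<le> l" "l \<le> j" for i l
  proof -
    have "log 2 (\<beta> i) \<le> log 2 (2 powr ((real l - real i) / 2) * \<beta> l)"
      using that pos[of i] pos[of l] ratio[OF that] by (subst log_le_cancel_iff) auto
    also have "\<dots> = (real l - real i) / 2 + log 2 (\<beta> l)"
      using that pos[of l] by (subst log_mult) auto
    finally show ?thesis by (simp add: field_simps)
  qed
  have gauss: "(\<Sum>i=1..p. real i / 2) = real p * (real p + 1) / 4" for p
    by (induction p) (auto simp: field_simps)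
  have lp: "log 2 (\<Prod>i=1..p. \<beta> i) = (\<Sum>i=1..p. log 2 (\<beta> i))" if "p \<le> j" for p
  proof -
    have "ln (\<Prod>i=1..p. \<beta> i) = (\<Sum>i=1..p. ln (\<beta> i))"
      using that pos by (intro ln_prod) force+
    then show ?thesis
      by (simp add: log_def sum_divide_distrib)
  qed
  have pp: "(\<Prod>i=1..p. \<beta> i) > 0" if "p \<le> j" for p
    using that pos by (intro prod_pos) auto
  have "real j * ((\<Sum>i=1..k. log 2 (\<beta> i)) + real k * (real k + 1) / 4)
      \<le> real k * ((\<Sum>i=1..j. log 2 (\<beta> i)) + real j * (real j + 1) / 4)"
    using sum_prefix_mean_le[OF assms(2), of "\<lambda>i. log 2 (\<beta> i) + real i / 2"] log_le
    unfolding sum.distrib gauss by blast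
  then have "(\<Sum>i=1..k. log 2 (\<beta> i))
      \<le> real k * (real j - real k) / 4 + real k / real j * (\<Sum>i=1..j. log 2 (\<beta> i))"
    using assms(1,2) by (simp add: field_simps)
  then have "2 powr log 2 (\<Prod>i=1..k. \<beta> i)
      \<le> 2 powr (real k * (real j - real k) / 4 + log 2 (\<Prod>i=1..j. \<beta> i) * (real k / real j))"
    using lp[of k] lp[of j] assms(2) by (simp add: mult.commute)
  also have "\<dots> = 2 powr (real k * (real j - real k) / 4)
      * (2 powr log 2 (\<Prod>i=1..j. \<beta> i)) powr (real k / real j)"
    by (simp only: powr_add powr_powr)
  finally show ?thesis
    using pp[of k] pp[of j] assms(2) by simp
qed

theorem theorem2:
  fixes b d :: "nat \<Rightarrow> real ^ 'm" and n k j :: nat and L :: "(real ^ 'm) set"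
  assumes "lattice_basis b n L"
    and "LLL_reduced b n"
    and "1 \<le> k" and "k \<le> j" and "j \<le> n"
    and "lin_indep_family d j"
    and "\<forall>i\<in>{1..j}. d i \<in> L"
  shows "lattice_det (lattice_gen b k)
      \<le> 2 powr (real k * (real n - real j) / 2 + real k * (real j - real k) / 4)
        * lattice_det (lattice_gen d j) powr (real k / real j)
    \<and> (\<Prod>i=1..k. norm (b i))
      \<le> 2 powr (real k * (real n - real j) / 2 + real k * (real j - 1) / 4)
        * lattice_det (lattice_gen d j) powr (real k / real j)"
proof -
  let ?P = "\<lambda>p. \<Prod>i=1..p. norm (gs_vec b i)"
  let ?D = "lattice_det (lattice_gen d j)"
  have b: "lin_indep_family b n" and L: "L = lattice_gen b n"
    using assms(1) unfolding lattice_basis_def by auto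
  have D: "?D = (\<Prod>i=1..j. norm (gs_vec d i))"
    using lattice_basis_gen[OF assms(6)] by (rule lattice_det_eq_prod_gs)
  then have D0: "?D \<ge> 0"
    by (simp add: prod_nonneg)
  have "?P j \<le> 2 powr (real j * (real n - real j) / 2) * ?D"
    unfolding D using assms(7) L
    by (intro prod_gs_le_sublattice[OF b _ assms(6)] LLL_gs_norm_le[OF assms(2)]) auto
  then have "?P j powr (real k / real j)
      \<le> (2 powr (real j * (real n - real j) / 2) * ?D) powr (real k / real j)"
    by (intro powr_mono2) (auto intro: prod_nonneg)
  also have "\<dots> = 2 powr (real k * (real n - real j) / 2) * ?D powr (real k / real j)"
    using assms(3,4) D0 by (simp add: powr_mult powr_powr mult.commute)
  finally have Pj: "?P j powr (real k / real j)
      \<le> 2 powr (real k * (real n - real j) / 2) * ?D powr (real k / real j)" .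
  have "?P k \<le> 2 powr (real k * (real j - real k) / 4) * ?P j powr (real k / real j)"
    using assms(5) gs_vec_nonzero[OF b]
    by (intro prod_prefix_le assms(3,4) LLL_gs_norm_le[OF assms(2)]) auto
  also have "\<dots> \<le> 2 powr (real k * (real j - real k) / 4)
      * (2 powr (real k * (real n - real j) / 2) * ?D powr (real k / real j))"
    using Pj by (intro mult_left_mono) auto
  also have "\<dots> = 2 powr (real k * (real n - real j) / 2 + real k * (real j - real k) / 4)
      * ?D powr (real k / real j)"
    by (simp add: powr_add mult_ac)
  finally have Pk: "?P k \<le> 2 powr (real k * (real n - real j) / 2 + real k * (real j - real k) / 4)
      * ?D powr (real k / real j)" .
  have "lattice_det (lattice_gen b k) = ?P k"
    using lin_indep_family_mono[OF b] assms(4,5)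
    by (intro lattice_det_eq_prod_gs lattice_basis_gen) simp
  moreover have "(\<Prod>i=1..k. norm (b i)) \<le> 2 powr (real k * (real n - real j) / 2 + real k * (real j - 1) / 4)
      * ?D powr (real k / real j)"
  proof -
    have exps: "(\<Prod>i=1..p. 2 powr ((real i - 1) / 2)) = (2::real) powr (real p * (real p - 1) / 4)" for p
      by (induction p) (simp_all add: powr_add[symmetric] field_simps)
    have "(\<Prod>i=1..k. norm (b i)) \<le> (\<Prod>i=1..k. 2 powr ((real i - 1) / 2) * norm (gs_vec b i))"
      using assms(4,5) by (intro prod_mono conjI LLL_norm_le_gs_norm[OF assms(2)]) auto
    also have "\<dots> = 2 powr (real k * (real k - 1) / 4) * ?P k"
      by (simp only: prod.distrib exps)
    also have "\<dots> \<le> 2 powr (real k * (real k - 1) / 4)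
        * (2 powr (real k * (real n - real j) / 2 + real k * (real j - real k) / 4)
          * ?D powr (real k / real j))"
      using Pk by (intro mult_left_mono) auto
    also have "\<dots> = 2 powr (real k * (real k - 1) / 4
          + (real k * (real n - real j) / 2 + real k * (real j - real k) / 4))
        * ?D powr (real k / real j)"
      by (simp add: powr_add)
    also have "real k * (real k - 1) / 4
          + (real k * (real n - real j) / 2 + real k * (real j - real k) / 4)
        = real k * (real n - real j) / 2 + real k * (real j - 1) / 4"
      by (simp add: field_simps)
    finally show ?thesis .
  qed
  ultimately show ?thesis
    using Pk by simp
qed

end
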